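(* The fractional programming problem $$\begin{array}{ll}\text{maximize} & \theta_o+\alpha t\\ \text{subject to} & \theta_o=\dfrac{y_o^{\top}v}{x_o^{\top}u},\\ & \theta_o\le 1,\\ & \dfrac{y_i^{\top}v}{x_i^{\top}u}\le 1-t\quad\forall i\in I\setminus\{o\},\\ & u\ge 0,\ v\ge 0,\\ & 0\le t\le 1\end{array}$$ can be transformed into the equivalent linear programming problem $$\begin{array}{ll}\text{maximize} & y_o^{\top}v-\alpha t'\\ \text{subject to} & x_o^{\top}u'=t',\\ & y_o^{\top}v\le 1,\\ & y_i^{\top}v\le x_i^{\top}u'\quad\forall i\in I\setminus\{o\},\\ & u'\ge 0,\ v\ge 0,\\ & 0\le t'\le 1.\end{array}$$ The transformation is as follows: one assumes $x_o^{\top}u=1$ without loss of generality; one sets $t'=1-t$, which gives the problem of maximizing $y_o^{\top}v+\alpha(1-t')$ subject to $x_o^{\top}u=1$, $y_o^{\top}v\le 1$, $y_i^{\top}v\le x_i^{\top}(t'u)$ for all $i\in I\setminus\{o\}$, $u\ge 0$, $v\ge 0$, $0\le t'\le 1$; one omits the additive constant $\alpha$ from the objective, which does not affect the optimal solution; and one introduces the variable transformation $u'=t'u$.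
   Context: There are $n$ decision making units (DMUs), indexed by $I=\{1,\dots,n\}$. DMU $i$ has input vector $x_i\in\mathbb{R}^l$ and output vector $y_i\in\mathbb{R}^m$, and all inputs and outputs are assumed strictly positive, i.e. $x_i>0$ and $y_i>0$ componentwise for every $i\in I$. The index $o\in I$ denotes the DMU being evaluated. The fractional program, in the variables $u\in\mathbb{R}^l$, $v\in\mathbb{R}^m$, $t\in\mathbb{R}$ (with $\theta_o$ determined by them), is the original formulation of the MM-DEA (Maximum-Margin Data Envelopment Analysis) model, where $t$ is the margin and $\alpha\ge 0$ is a predetermined trade-off parameter. The linear program has variables $u'\in\mathbb{R}^l$, $v\in\mathbb{R}^m$, $t'\in\mathbb{R}$. Vector inequalities are componentwise. *)

theory Defs
  imports "HOL-Analysis.Analysis"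
begin

text \<open>
  Data: \<open>n\<close> decision making units indexed by \<open>{1..n}\<close>, with input vectors \<open>x i\<close> and output
  vectors \<open>y i\<close>; the evaluated unit is called \<open>k\<close>, since the letter o denotes function
  composition. Feasible points of every program are triples. On \<open>real ^ 'l\<close> the library's
  \<open>0 \<le> u\<close> is the componentwise order, whereas its \<open>0 < u\<close> is not the componentwise strict one.
\<close>

definition efficiency :: "(nat \<Rightarrow> real ^ 'l) \<Rightarrow> (nat \<Rightarrow> real ^ 'm) \<Rightarrow> nat \<Rightarrow> real ^ 'l \<Rightarrow> real ^ 'm \<Rightarrow> real"
  where "efficiency x y i u v = (y i \<bullet> v) / (x i \<bullet> u)"

text \<open>
  The first condition says that all fractions in the program are defined; it has to be explicit
  because division by zero is total in HOL.
\<close>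

definition fp_feasible ::
  "nat \<Rightarrow> (nat \<Rightarrow> real ^ 'l) \<Rightarrow> (nat \<Rightarrow> real ^ 'm) \<Rightarrow> nat \<Rightarrow> ((real ^ 'l) \<times> (real ^ 'm) \<times> real) set"
  where "fp_feasible n x y k =
    {(u, v, t). (\<forall>i\<in>{1..n}. x i \<bullet> u \<noteq> 0)
       \<and> efficiency x y k u v \<le> 1
       \<and> (\<forall>i\<in>{1..n} - {k}. efficiency x y i u v \<le> 1 - t)
       \<and> 0 \<le> u \<and> 0 \<le> v \<and> 0 \<le> t \<and> t \<le> 1}"

definition fp_objective ::
  "(nat \<Rightarrow> real ^ 'l) \<Rightarrow> (nat \<Rightarrow> real ^ 'm) \<Rightarrow> nat \<Rightarrow> real \<Rightarrow> (real ^ 'l) \<times> (real ^ 'm) \<times> real \<Rightarrow> real"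
  where "fp_objective x y k \<alpha> = (\<lambda>(u, v, t). efficiency x y k u v + \<alpha> * t)"

text \<open>The intermediate program, obtained from \<open>x k \<bullet> u = 1\<close> and \<open>t' = 1 - t\<close>.\<close>

definition np_feasible ::
  "nat \<Rightarrow> (nat \<Rightarrow> real ^ 'l) \<Rightarrow> (nat \<Rightarrow> real ^ 'm) \<Rightarrow> nat \<Rightarrow> ((real ^ 'l) \<times> (real ^ 'm) \<times> real) set"
  where "np_feasible n x y k =
    {(u, v, t'). x k \<bullet> u = 1
       \<and> y k \<bullet> v \<le> 1
       \<and> (\<forall>i\<in>{1..n} - {k}. y i \<bullet> v \<le> x i \<bullet> (t' *\<^sub>R u))
       \<and> 0 \<le> u \<and> 0 \<le> v \<and> 0 \<le> t' \<and> t' \<le> 1}"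

definition np_objective ::
  "(nat \<Rightarrow> real ^ 'm) \<Rightarrow> nat \<Rightarrow> real \<Rightarrow> (real ^ 'l) \<times> (real ^ 'm) \<times> real \<Rightarrow> real"
  where "np_objective y k \<alpha> = (\<lambda>(u, v, t'). y k \<bullet> v + \<alpha> * (1 - t'))"

definition lp_feasible ::
  "nat \<Rightarrow> (nat \<Rightarrow> real ^ 'l) \<Rightarrow> (nat \<Rightarrow> real ^ 'm) \<Rightarrow> nat \<Rightarrow> ((real ^ 'l) \<times> (real ^ 'm) \<times> real) set"
  where "lp_feasible n x y k =
    {(u', v, t'). x k \<bullet> u' = t'
       \<and> y k \<bullet> v \<le> 1
       \<and> (\<forall>i\<in>{1..n} - {k}. y i \<bullet> v \<le> x i \<bullet> u')
       \<and> 0 \<le> u' \<and> 0 \<le> v \<and> 0 \<le> t' \<and> t' \<le> 1}"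

definition lp_objective ::
  "(nat \<Rightarrow> real ^ 'm) \<Rightarrow> nat \<Rightarrow> real \<Rightarrow> (real ^ 'l) \<times> (real ^ 'm) \<times> real \<Rightarrow> real"
  where "lp_objective y k \<alpha> = (\<lambda>(u', v, t'). y k \<bullet> v - \<alpha> * t')"

text \<open>
  The map \<open>T\<close> transforms the problem of maximizing \<open>f\<close> over \<open>S\<close> into the equivalent problem of
  maximizing \<open>g\<close> over \<open>S'\<close>, up to an additive constant \<open>c\<close> in the objective. Surjectivity
  means that nothing is added to the problem; \<open>T\<close> need not be injective (solutions may be
  rescaled, and \<open>u' = t' u\<close> forgets \<open>u\<close> when \<open>t' = 0\<close>).
\<close>

definition transforms_max ::
  "('a \<Rightarrow> 'b) \<Rightarrow> 'a set \<Rightarrow> ('a \<Rightarrow> real) \<Rightarrow> 'b set \<Rightarrow> ('b \<Rightarrow> real) \<Rightarrow> real \<Rightarrow> bool"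
  where "transforms_max T S f S' g c \<longleftrightarrow>
    T ` S = S'
    \<and> (\<forall>z\<in>S. f z = g (T z) + c)
    \<and> (\<forall>z\<in>S. is_arg_max f (\<lambda>w. w \<in> S) z \<longleftrightarrow> is_arg_max g (\<lambda>w. w \<in> S') (T z))"

end

(* Each step of the transformation is a surjection between feasible sets along which the objective
   changes only by a constant; this alone makes maximizers correspond, and it is closed under
   composition. Since the inputs are positive, for u \<ge> 0 the condition u \<noteq> 0 amounts to x i \<bullet> u > 0
   for one i, and hence for every i, so all denominators can be cleared. In the step u' = t' u, a
   point with t' = 0 has u' = 0 and is reached from any normalized u. *)
theory Submission
  imports Defs
begin

section \<open>Transformations between maximization problems\<close>

lemma transforms_maxI:
  assumes "T ` S = S'" and "\<And>z. z \<in> S \<Longrightarrow> f z = g (T z) + c"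
  shows "transforms_max T S f S' g c"
proof -
  have "is_arg_max f (\<lambda>w. w \<in> S) z \<longleftrightarrow> is_arg_max g (\<lambda>w. w \<in> S') (T z)" if "z \<in> S" for z
    \<comment> \<open>Every competitor in \<open>S'\<close> has the form \<open>T w\<close> with
      \<open>w\<close> in \<open>S\<close>, and \<open>c\<close> cancels when two objective values
      are compared.\<close>
    using assms(2) that by (auto simp: is_arg_max_linorder assms(1)[symmetric])
  with assms show ?thesis
    by (auto simp: transforms_max_def)
qed

lemma transforms_max_comp:
  assumes "transforms_max T S f S' g c" and "transforms_max T' S' g S'' h d"
  shows "transforms_max (T' \<circ> T) S f S'' h (c + d)"
proof (rule transforms_maxI)
  show "(T' \<circ> T) ` S = S''"
    using assms unfolding transforms_max_def image_comp[symmetric] by simp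
  show "f z = h ((T' \<circ> T) z) + (c + d)" if "z \<in> S" for z
    using assms that by (auto simp: transforms_max_def)
qed

lemma transforms_max_is_arg_max_iff:
  assumes "transforms_max T S f S' g c" and "z \<in> S"
  shows "is_arg_max f (\<lambda>w. w \<in> S) z \<longleftrightarrow> is_arg_max g (\<lambda>w. w \<in> S') (T z)"
  using assms by (simp add: transforms_max_def)

text \<open>The supremum is reindexed along the surjection \<open>T\<close> and the constant pulled
  out. Working in \<open>ereal\<close> covers empty feasible sets and unbounded objectives.\<close>

lemma transforms_max_SUP:
  assumes "transforms_max T S f S' g c"
  shows "(SUP z\<in>S. ereal (f z)) = (SUP z\<in>S'. ereal (g z)) + ereal c"
proof (cases "S = {}")
  case True
  then have "S' = {}"
    using assms by (auto simp: transforms_max_def)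
  with True show ?thesis
    \<comment> \<open>Both suprema are -\<infinity>, which absorbs the real constant. This case is
      separate because pulling the constant out needs a nonempty index set.\<close>
    by (simp add: bot_ereal_def)
next
  case False
  have "(SUP z\<in>S. ereal (f z)) = (SUP z\<in>S. ereal (g (T z)) + ereal c)"
    using assms by (intro SUP_cong) (auto simp: transforms_max_def)
  also have "\<dots> = (SUP z\<in>S. ereal (g (T z))) + ereal c"
    using False by (intro SUP_ereal_add_left) auto
  also have "(SUP z\<in>S. ereal (g (T z))) = (SUP z\<in>S'. ereal (g z))"
    using assms by (auto simp: transforms_max_def image_comp comp_def)
  finally show ?thesis .
qed

section \<open>Positivity and scaling of weights\<close>

lemma inner_pos_of_pos_vec:
  fixes a u :: "real ^ 'n"
  assumes "\<forall>j. 0 < a $ j" and "0 \<le> u" and "u \<noteq> 0"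
  shows "0 < a \<bullet> u"
proof -
  from \<open>u \<noteq> 0\<close> obtain j where "u $ j \<noteq> 0"
    by (auto simp: vec_eq_iff)
  with assms(2) have "0 < u $ j"
    by (simp add: less_eq_vec_def order.strict_iff_order)
  then have "0 < a $ j * u $ j"
    using assms(1) by simp
  moreover have "0 \<le> a $ i * u $ i" for i
    using assms(1,2) by (simp add: less_eq_vec_def less_imp_le)
  ultimately show ?thesis
    \<comment> \<open>The term at \<open>j\<close> is positive and no other term is
      negative.\<close>
    unfolding inner_vec_def inner_real_def by (intro sum_pos2[of UNIV j]) auto
qed

lemma scaleR_vec_nonneg:
  fixes u :: "real ^ 'n"
  assumes "0 \<le> c" and "0 \<le> u"
  shows "0 \<le> c *\<^sub>R u"
  using assms by (simp add: less_eq_vec_def)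

lemma efficiency_scaleR:
  assumes "c \<noteq> 0"
  shows "efficiency x y i (c *\<^sub>R u) (c *\<^sub>R v) = efficiency x y i u v"
  using assms by (simp add: efficiency_def)

section \<open>The steps of the transformation for positive inputs\<close>

locale positive_inputs =
  fixes n k :: nat
    and x :: "nat \<Rightarrow> real ^ 'l"
    and y :: "nat \<Rightarrow> real ^ 'm"
    and \<alpha> :: real
  assumes k: "k \<in> {1..n}"
    and x_pos: "i \<in> {1..n} \<Longrightarrow> 0 < x i $ j"
begin

lemma inner_pos:
  assumes "i \<in> {1..n}" and "0 \<le> u" and "u \<noteq> 0"
  shows "0 < x i \<bullet> u"
  using assms x_pos by (intro inner_pos_of_pos_vec) auto

lemma fp_feasible_inner_pos:
  assumes "(u, v, t) \<in> fp_feasible n x y k"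
  shows "0 < x k \<bullet> u"
proof -
  from assms k have "x k \<bullet> u \<noteq> 0" and "0 \<le> u"
    by (auto simp: fp_feasible_def)
  then show ?thesis
    using k by (intro inner_pos) auto
qed

text \<open>Efficiencies are homogeneous of degree zero in \<open>u\<close> and \<open>v\<close>
  jointly, and \<open>t\<close> is left alone; this is what permits the normalization
  \<open>x k \<bullet> u = 1\<close>.\<close>

lemma fp_feasible_scaleR:
  assumes "(u, v, t) \<in> fp_feasible n x y k" and "0 < c"
  shows "(c *\<^sub>R u, c *\<^sub>R v, t) \<in> fp_feasible n x y k"
  using assms by (auto simp: fp_feasible_def efficiency_scaleR scaleR_vec_nonneg)

lemma transforms_max_normalize:
  "transforms_max (\<lambda>(u, v, t). ((1 / (x k \<bullet> u)) *\<^sub>R u, (1 / (x k \<bullet> u)) *\<^sub>R v, t))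
     (fp_feasible n x y k) (fp_objective x y k \<alpha>)
     {(u, v, t) \<in> fp_feasible n x y k. x k \<bullet> u = 1} (fp_objective x y k \<alpha>) 0"
    (is "transforms_max ?T ?S _ ?S' _ _")
proof (rule transforms_maxI)
  show "?T ` ?S = ?S'"
  proof (intro equalityI subsetI)
    fix w assume "w \<in> ?T ` ?S"
    then obtain u v t where uvt: "(u, v, t) \<in> ?S" and w: "w = ?T (u, v, t)"
      by auto
    from fp_feasible_inner_pos[OF uvt] fp_feasible_scaleR[OF uvt, of "1 / (x k \<bullet> u)"]
    show "w \<in> ?S'"
      by (simp add: w)
  next
    fix w assume "w \<in> ?S'"
    \<comment> \<open>On normalized points the scaling factor is 1, so they are their own
      preimages.\<close>
    then have "w \<in> ?S" and "w = ?T w"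
      by auto
    then show "w \<in> ?T ` ?S"
      by blast
  qed
  show "fp_objective x y k \<alpha> z = fp_objective x y k \<alpha> (?T z) + 0" if "z \<in> ?S" for z
  proof -
    obtain u v t where z: "z = (u, v, t)"
      by (cases z)
    with that have "0 < x k \<bullet> u"
      using fp_feasible_inner_pos by simp
    then show ?thesis
      using efficiency_scaleR[of "1 / (x k \<bullet> u)" x y k u v] by (simp add: z fp_objective_def)
  qed
qed

text \<open>Normalization forces \<open>u \<noteq> 0\<close>, so all denominators are positive: the
  fractions are defined and the ratio constraints can be cleared. If normalization or
  \<open>0 \<le> u\<close> fails, both sides are false.\<close>

lemma np_feasible_iff:
  "(u, v, t') \<in> np_feasible n x y k \<longleftrightarrow> (u, v, 1 - t') \<in> fp_feasible n x y k \<and> x k \<bullet> u = 1"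
proof (cases "x k \<bullet> u = 1 \<and> 0 \<le> u")
  case True
  then have pos: "0 < x i \<bullet> u" if "i \<in> {1..n}" for i
    using that by (intro inner_pos) auto
  then have "efficiency x y i u v \<le> t' \<longleftrightarrow> y i \<bullet> v \<le> x i \<bullet> (t' *\<^sub>R u)" if "i \<in> {1..n}" for i
    using that by (simp add: efficiency_def pos_divide_le_eq)
  moreover have "efficiency x y k u v = y k \<bullet> v"
    using True by (simp add: efficiency_def)
  moreover have "\<forall>i\<in>{1..n}. x i \<bullet> u \<noteq> 0"
    using pos by (metis less_irrefl)
  ultimately show ?thesis
    using True by (auto simp: fp_feasible_def np_feasible_def)
next
  case False
  then show ?thesis
    by (auto simp: fp_feasible_def np_feasible_def)
qed

lemma transforms_max_complement:
  "transforms_max (\<lambda>(u, v, t). (u, v, 1 - t))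
     {(u, v, t) \<in> fp_feasible n x y k. x k \<bullet> u = 1} (fp_objective x y k \<alpha>)
     (np_feasible n x y k) (np_objective y k \<alpha>) 0"
    (is "transforms_max ?T ?S _ ?S' _ _")
proof (rule transforms_maxI)
  show "?T ` ?S = ?S'"
  proof (intro equalityI subsetI)
    fix w assume "w \<in> ?T ` ?S"
    then show "w \<in> ?S'"
      by (auto simp: np_feasible_iff)
  next
    fix w assume "w \<in> ?S'"
    \<comment> \<open>Complementing the third component is an involution, so \<open>?T w\<close> is
      a preimage of \<open>w\<close>.\<close>
    then have "?T w \<in> ?S" and "w = ?T (?T w)"
      by (auto simp: np_feasible_iff split: prod.splits)
    then show "w \<in> ?T ` ?S"
      by (intro image_eqI)
  qed
  show "fp_objective x y k \<alpha> z = np_objective y k \<alpha> (?T z) + 0" if "z \<in> ?S" for z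
    using that by (auto simp: fp_objective_def np_objective_def efficiency_def)
qed

lemma transforms_max_drop_const:
  "transforms_max (\<lambda>z. z)
     (np_feasible n x y k) (np_objective y k \<alpha>)
     (np_feasible n x y k) (\<lambda>(u, v, t'). y k \<bullet> v - \<alpha> * t') \<alpha>"
  by (rule transforms_maxI) (auto simp: np_objective_def algebra_simps)

text \<open>This supplies the surjectivity of the step \<open>u' = t' u\<close>: a nonzero
  \<open>u'\<close> is divided by \<open>x k \<bullet> u'\<close>.\<close>

lemma exists_normalized_preimage:
  assumes "0 \<le> u'"
  obtains u where "0 \<le> u" and "x k \<bullet> u = 1" and "u' = (x k \<bullet> u') *\<^sub>R u"
proof (cases "u' = 0")
  case True
  \<comment> \<open>Here \<open>1\<close> is the all-ones vector; rescaled, it serves as a concrete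
    normalized \<open>u\<close>.\<close>
  have one: "0 \<le> (1 :: real ^ 'l)"
    by (simp add: less_eq_vec_def)
  moreover have "(1 :: real ^ 'l) \<noteq> 0"
    by (simp add: vec_eq_iff)
  ultimately have "0 < x k \<bullet> 1"
    by (rule inner_pos[OF k])
  with one show ?thesis
    using True by (intro that[of "(1 / (x k \<bullet> 1)) *\<^sub>R 1"] scaleR_vec_nonneg) auto
next
  case False
  then have "0 < x k \<bullet> u'"
    using assms by (intro inner_pos[OF k])
  with assms show ?thesis
    by (intro that[of "(1 / (x k \<bullet> u')) *\<^sub>R u'"] scaleR_vec_nonneg) auto
qed

lemma transforms_max_linearize:
  "transforms_max (\<lambda>(u, v, t'). (t' *\<^sub>R u, v, t'))
     (np_feasible n x y k) (\<lambda>(u, v, t'). y k \<bullet> v - \<alpha> * t')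
     (lp_feasible n x y k) (lp_objective y k \<alpha>) 0"
    (is "transforms_max ?T ?S _ ?S' _ _")
proof (rule transforms_maxI)
  show "?T ` ?S = ?S'"
  proof (intro equalityI subsetI)
    fix w assume "w \<in> ?T ` ?S"
    then show "w \<in> ?S'"
      by (auto simp: np_feasible_def lp_feasible_def scaleR_vec_nonneg)
  next
    fix w assume "w \<in> ?S'"
    then obtain u' v t' where w: "w = (u', v, t')" and lp: "(u', v, t') \<in> ?S'"
      by (cases w) auto
    then have "0 \<le> u'" and t': "x k \<bullet> u' = t'"
      by (auto simp: lp_feasible_def)
    from exists_normalized_preimage[OF this(1)] this(2)
    obtain u where u: "0 \<le> u" "x k \<bullet> u = 1" "u' = t' *\<^sub>R u"
      by metis
    \<comment> \<open>After substituting \<open>u' = t' *\<^sub>R u\<close>, the ratio constraints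
      of the two programs coincide.\<close>
    with lp have "(u, v, t') \<in> ?S"
      by (auto simp: np_feasible_def lp_feasible_def)
    with u(3) show "w \<in> ?T ` ?S"
      by (force simp: w)
  qed
  show "(case z of (u, v, t') \<Rightarrow> y k \<bullet> v - \<alpha> * t') = lp_objective y k \<alpha> (?T z) + 0" for z
    by (simp add: lp_objective_def split: prod.split)
qed

section \<open>From the fractional to the linear program and back\<close>

lemma transforms_max_fp_lp:
  "transforms_max (\<lambda>(u, v, t). (((1 - t) / (x k \<bullet> u)) *\<^sub>R u, (1 / (x k \<bullet> u)) *\<^sub>R v, 1 - t))
     (fp_feasible n x y k) (fp_objective x y k \<alpha>)
     (lp_feasible n x y k) (lp_objective y k \<alpha>) \<alpha>"
  \<comment> \<open>The factors \<open>1 / (x k \<bullet> u)\<close> and \<open>1 - t\<close>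
    multiply, and the constants add up to \<open>\<alpha>\<close>, which comes from the third step
    only.\<close>
  using transforms_max_comp[OF transforms_max_comp[OF transforms_max_comp[OF
        transforms_max_normalize transforms_max_complement] transforms_max_drop_const]
      transforms_max_linearize]
  by (simp add: comp_def case_prod_beta')

lemma lp_arg_max_lift:
  assumes "is_arg_max (lp_objective y k \<alpha>) (\<lambda>w. w \<in> lp_feasible n x y k) (u', v, t')"
  shows "\<exists>u. x k \<bullet> u = 1 \<and> u' = t' *\<^sub>R u
    \<and> is_arg_max (fp_objective x y k \<alpha>) (\<lambda>w. w \<in> fp_feasible n x y k) (u, v, 1 - t')"
proof -
  have "(u', v, t') \<in> lp_feasible n x y k"
    using assms by (simp add: is_arg_max_def)
  then obtain u where np: "(u, v, t') \<in> np_feasible n x y k" and u': "u' = t' *\<^sub>R u"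
    using transforms_max_linearize unfolding transforms_max_def by force
  then have "(u, v, 1 - t') \<in> fp_feasible n x y k" and "x k \<bullet> u = 1"
    by (auto simp: np_feasible_iff)
  \<comment> \<open>Since \<open>x k \<bullet> u = 1\<close>, the composite map sends
    \<open>(u, v, 1 - t')\<close> to \<open>(t' *\<^sub>R u, v, t')\<close>, the given
    maximizer.\<close>
  with assms u' show ?thesis
    using transforms_max_is_arg_max_iff[OF transforms_max_fp_lp, of "(u, v, 1 - t')"] by auto
qed

end

theorem mainTheorem2:
  fixes n k :: nat
    and x :: "nat \<Rightarrow> real ^ 'l"
    and y :: "nat \<Rightarrow> real ^ 'm"
    and \<alpha> :: real
  assumes "k \<in> {1..n}"
    and "\<forall>i\<in>{1..n}. \<forall>j. 0 < x i $ j"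
    and "\<forall>i\<in>{1..n}. \<forall>j. 0 < y i $ j"
    and "0 \<le> \<alpha>"
  shows "
    \<comment> \<open>one may assume \<open>x k \<bullet> u = 1\<close>\<close>
      (transforms_max (\<lambda>(u, v, t). ((1 / (x k \<bullet> u)) *\<^sub>R u, (1 / (x k \<bullet> u)) *\<^sub>R v, t))
       (fp_feasible n x y k) (fp_objective x y k \<alpha>)
       {(u, v, t) \<in> fp_feasible n x y k. x k \<bullet> u = 1} (fp_objective x y k \<alpha>) 0)
    \<comment> \<open>\<open>t' = 1 - t\<close>\<close>
    \<and> (transforms_max (\<lambda>(u, v, t). (u, v, 1 - t))
       {(u, v, t) \<in> fp_feasible n x y k. x k \<bullet> u = 1} (fp_objective x y k \<alpha>)
       (np_feasible n x y k) (np_objective y k \<alpha>) 0)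
    \<comment> \<open>omission of the constant \<open>\<alpha>\<close>\<close>
    \<and> (transforms_max (\<lambda>z. z)
       (np_feasible n x y k) (np_objective y k \<alpha>)
       (np_feasible n x y k) (\<lambda>(u, v, t'). y k \<bullet> v - \<alpha> * t') \<alpha>)
    \<comment> \<open>\<open>u' = t' u\<close>\<close>
    \<and> (transforms_max (\<lambda>(u, v, t'). (t' *\<^sub>R u, v, t'))
       (np_feasible n x y k) (\<lambda>(u, v, t'). y k \<bullet> v - \<alpha> * t')
       (lp_feasible n x y k) (lp_objective y k \<alpha>) 0)
    \<comment> \<open>the fractional program and the linear program are equivalent\<close>
    \<and> (transforms_max
       (\<lambda>(u, v, t). (((1 - t) / (x k \<bullet> u)) *\<^sub>R u, (1 / (x k \<bullet> u)) *\<^sub>R v, 1 - t))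
       (fp_feasible n x y k) (fp_objective x y k \<alpha>)
       (lp_feasible n x y k) (lp_objective y k \<alpha>) \<alpha>)
    \<and> (\<forall>u' v t'. is_arg_max (lp_objective y k \<alpha>) (\<lambda>w. w \<in> lp_feasible n x y k) (u', v, t') \<longrightarrow>
       (\<exists>u. x k \<bullet> u = 1 \<and> u' = t' *\<^sub>R u
          \<and> is_arg_max (fp_objective x y k \<alpha>) (\<lambda>w. w \<in> fp_feasible n x y k) (u, v, 1 - t')))
    \<and> ((SUP z\<in>fp_feasible n x y k. ereal (fp_objective x y k \<alpha> z)) =
       (SUP z\<in>lp_feasible n x y k. ereal (lp_objective y k \<alpha> z)) + ereal \<alpha>)"
proof -
  interpret positive_inputs n k x y \<alpha>
    using assms by unfold_locales auto
  show ?thesis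
    by (intro conjI allI impI transforms_max_normalize transforms_max_complement
        transforms_max_drop_const transforms_max_linearize transforms_max_fp_lp lp_arg_max_lift
        transforms_max_SUP[OF transforms_max_fp_lp])
qed

end
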